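(* Let $S$ be a semigroup and let $I$ be a maximal ideal of $S$. If $I$ is a maximal subsemigroup of $S$ and $\mathrm{Sep}I\neq\emptyset$, then $I$ is a prime ideal of $S$.
   Context: For a subset $A$ of a semigroup $S$, write $\overline{A}=S\setminus A$. The separator of $A$, denoted $\mathrm{Sep}A$, is the set of all $x\in S$ such that $xA\subseteq A$, $Ax\subseteq A$, $x\overline{A}\subseteq\overline{A}$ and $\overline{A}x\subseteq\overline{A}$. Ideals are two-sided. An ideal $M\neq S$ of $S$ is called maximal if, for every ideal $A$ of $S$, $M\subseteq A\subseteq S$ implies $M=A$ or $A=S$. A maximal subsemigroup of $S$ is a subsemigroup $M\neq S$ such that every subsemigroup $A$ of $S$ with $M\subseteq A\subseteq S$ satisfies $A=M$ or $A=S$. An ideal $P$ of $S$ is called prime if $P\neq S$ and, for all $a,b\in S$, $ab\in P$ implies $a\in P$ or $b\in P$. *)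

theory Defs
  imports Main
begin

definition separator :: "'a::semigroup_mult set \<Rightarrow> 'a set" where
  "separator A = {x. (\<lambda>a. x * a) ` A \<subseteq> A \<and> (\<lambda>a. a * x) ` A \<subseteq> A
                   \<and> (\<lambda>a. x * a) ` (- A) \<subseteq> - A \<and> (\<lambda>a. a * x) ` (- A) \<subseteq> - A}"

text \<open>Subsemigroups and ideals are not required to be nonempty. The sets compared with a
  maximal one all contain it, so for nonempty sets the two maximality notions below do not
  depend on this convention.\<close>

definition subsemigroup :: "'a::semigroup_mult set \<Rightarrow> bool" where
  "subsemigroup A \<longleftrightarrow> (\<forall>a\<in>A. \<forall>b\<in>A. a * b \<in> A)"

definition semigroup_ideal :: "'a::semigroup_mult set \<Rightarrow> bool" where
  "semigroup_ideal A \<longleftrightarrow> (\<forall>a\<in>A. \<forall>s. s * a \<in> A \<and> a * s \<in> A)"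

definition maximal_ideal :: "'a::semigroup_mult set \<Rightarrow> bool" where
  "maximal_ideal M \<longleftrightarrow> semigroup_ideal M \<and> M \<noteq> UNIV \<and>
     (\<forall>A. semigroup_ideal A \<longrightarrow> M \<subseteq> A \<longrightarrow> M = A \<or> A = UNIV)"

definition maximal_subsemigroup :: "'a::semigroup_mult set \<Rightarrow> bool" where
  "maximal_subsemigroup M \<longleftrightarrow> subsemigroup M \<and> M \<noteq> UNIV \<and>
     (\<forall>A. subsemigroup A \<longrightarrow> M \<subseteq> A \<longrightarrow> A = M \<or> A = UNIV)"

definition prime_ideal :: "'a::semigroup_mult set \<Rightarrow> bool" where
  "prime_ideal P \<longleftrightarrow> semigroup_ideal P \<and> P \<noteq> UNIV \<and>
     (\<forall>a b. a * b \<in> P \<longrightarrow> a \<in> P \<or> b \<in> P)"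

end

theory Submission
  imports Defs
begin

text \<open>\<open>separator I\<close> is a subsemigroup disjoint from the ideal \<open>I \<noteq> S\<close>, so \<open>I \<union> separator I\<close> is a
  subsemigroup strictly containing \<open>I\<close>, hence all of \<open>S\<close>. Thus every element outside \<open>I\<close> lies in
  the separator and maps the complement of \<open>I\<close> into itself.\<close>

text \<open>Stability of the complement \<open>- A\<close> is the contrapositive of the backward
  implications.\<close>

lemma separator_iff:
  "x \<in> separator A \<longleftrightarrow> (\<forall>a. (x * a \<in> A \<longleftrightarrow> a \<in> A) \<and> (a * x \<in> A \<longleftrightarrow> a \<in> A))"
  unfolding separator_def by blast

lemma subsemigroup_separator: "subsemigroup (separator A)"
  unfolding subsemigroup_def
proof (intro ballI)
  fix x y
  assume "x \<in> separator A" "y \<in> separator A"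
  then have x: "x * a \<in> A \<longleftrightarrow> a \<in> A" "a * x \<in> A \<longleftrightarrow> a \<in> A"
    and y: "y * a \<in> A \<longleftrightarrow> a \<in> A" "a * y \<in> A \<longleftrightarrow> a \<in> A" for a
    unfolding separator_iff by blast+
  have "(x * y) * a \<in> A \<longleftrightarrow> a \<in> A" for a
    by (simp only: mult.assoc x y)
  moreover have "a * (x * y) \<in> A \<longleftrightarrow> a \<in> A" for a
    by (simp only: mult.assoc[symmetric] x y)
  ultimately show "x * y \<in> separator A"
    unfolding separator_iff by blast
qed

text \<open>Mixed products are absorbed by the ideal \<open>A\<close>.\<close>

lemma subsemigroup_ideal_Un:
  assumes "semigroup_ideal A" "subsemigroup B"
  shows "subsemigroup (A \<union> B)"
  using assms unfolding semigroup_ideal_def subsemigroup_def by blast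

text \<open>If \<open>x\<close> were in both and \<open>y \<notin> A\<close>, then
  \<open>x * y\<close> would lie in \<open>A\<close> by absorption but outside \<open>A\<close> by
  separation.\<close>

lemma separator_ideal_disjoint:
  assumes "semigroup_ideal A" "A \<noteq> UNIV"
  shows "separator A \<inter> A = {}"
proof -
  obtain y where "y \<notin> A" using assms(2) by blast
  then show ?thesis
    using assms(1) unfolding semigroup_ideal_def by (auto simp: separator_iff)
qed

theorem theorem10:
  fixes I :: "'a::semigroup_mult set"
  assumes "maximal_ideal I"
    and "maximal_subsemigroup I"
    and "separator I \<noteq> {}"
  shows "prime_ideal I"
proof -
  have ideal: "semigroup_ideal I" "I \<noteq> UNIV"
    using assms(1) unfolding maximal_ideal_def by auto
  have "subsemigroup (I \<union> separator I)"
    using ideal(1) subsemigroup_separator by (rule subsemigroup_ideal_Un)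
  then have "I \<union> separator I = I \<or> I \<union> separator I = UNIV"
    using assms(2) unfolding maximal_subsemigroup_def by blast
  \<comment> \<open>A nonempty set disjoint from \<open>I\<close> makes the union strictly larger
    than \<open>I\<close>.\<close>
  then have "I \<union> separator I = UNIV"
    using assms(3) separator_ideal_disjoint[OF ideal] by blast
  then have "a * b \<notin> I" if "a \<notin> I" "b \<notin> I" for a b
    using that separator_iff[of a I] by blast
  then show ?thesis
    using ideal unfolding prime_ideal_def by blast
qed

end
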